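(* There is no distance-regular graph with intersection array $\{55,54,50,35,10;1,5,20,45,55\}$.
   Context: A connected graph $\Gamma$ of diameter $d$ is distance-regular if there are constants $p^h_{ij}$ ($0\le h,i,j\le d$) such that for any two vertices $u,v$ at distance $h$, the number of vertices at distance $i$ from $u$ and distance $j$ from $v$ is $p^h_{ij}$. Its intersection array is $\{b_0,b_1,\dots,b_{d-1};c_1,c_2,\dots,c_d\}$ where $b_i=p^i_{1,i+1}$ and $c_{i+1}=p^{i+1}_{1,i}$. *)

theory Defs
  imports "Graph_Theory.Graph_Theory"
begin

definition gdist :: "('a, 'b) pre_digraph \<Rightarrow> 'a \<Rightarrow> 'a \<Rightarrow> nat" where
  "gdist G u v = (LEAST n. \<exists>p. pre_digraph.awalk G u p v \<and> length p = n)"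

lemma (in wf_digraph) shortest_path_unit_eq_gdist:
  assumes "u \<rightarrow>\<^sup>* v"
  shows "\<mu> (\<lambda>_. 1) u v = ereal (real (gdist G u v))"
proof -
  have ex: "\<exists>n p. awalk u p v \<and> length p = n"
    using assms by (auto simp: reachable_awalk)
  have cost: "awalk_cost (\<lambda>_. 1) p = real (length p)" for p
    by (induct p) auto
  from LeastI_ex[OF ex] obtain p where p: "awalk u p v" "length p = gdist G u v"
    unfolding gdist_def by auto
  have "gdist G u v \<le> length q" if "awalk u q v" for q
    unfolding gdist_def using that by (intro Least_le) auto
  then show ?thesis
    unfolding \<mu>_def cost using p by (intro antisym INF_greatest INF_lower2[of p]) auto
qed

definition gdiameter :: "('a, 'b) pre_digraph \<Rightarrow> nat" where
  "gdiameter G = Max {gdist G u v | u v. u \<in> verts G \<and> v \<in> verts G}"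

text \<open>
  The family \<open>p h i j\<close> collects the numbers $p^h_{ij}$; only its values for
  \<open>h, i, j \<le> gdiameter G\<close> are constrained, and for connected \<open>G\<close> these are unique,
  because every distance up to the diameter is attained.
\<close>
definition intersection_numbers ::
    "('a, 'b) pre_digraph \<Rightarrow> (nat \<Rightarrow> nat \<Rightarrow> nat \<Rightarrow> nat) \<Rightarrow> bool" where
  "intersection_numbers G p \<longleftrightarrow>
    (\<forall>h \<le> gdiameter G. \<forall>i \<le> gdiameter G. \<forall>j \<le> gdiameter G.
      \<forall>u \<in> verts G. \<forall>v \<in> verts G. gdist G u v = h \<longrightarrow>
        card {w \<in> verts G. gdist G u w = i \<and> gdist G v w = j} = p h i j)"

text \<open>
  The locale \<open>graph\<close> describes finite simple undirected graphs, an edge being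
  represented by its two opposite arcs.
\<close>
definition distance_regular :: "('a, 'b) pre_digraph \<Rightarrow> bool" where
  "distance_regular G \<longleftrightarrow>
    graph G \<and> Digraph_Component.connected G \<and> (\<exists>p. intersection_numbers G p)"

text \<open>
  The lists are $b_0, \ldots, b_{d-1}$ and $c_1, \ldots, c_d$, where $d$ is the diameter;
  thus \<open>cs ! i\<close> is $c_{i+1}$.
\<close>
definition has_intersection_array ::
    "('a, 'b) pre_digraph \<Rightarrow> nat list \<Rightarrow> nat list \<Rightarrow> bool" where
  "has_intersection_array G bs cs \<longleftrightarrow>
    length bs = gdiameter G \<and> length cs = gdiameter G \<and>
    (\<exists>p. intersection_numbers G p \<and>
      (\<forall>i < gdiameter G. bs ! i = p i 1 (i + 1) \<and> cs ! i = p (i + 1) 1 i))"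

end

theory Submission
  imports Defs
begin

text \<open>
  The array forces the graph to be bipartite with rational eigenvalues, and the Krein parameters
  \<open>q\<^sup>4\<^sub>4\<^sub>4\<close> and \<open>q\<^sup>3\<^sub>4\<^sub>4\<close> vanish. Each vanishing Krein parameter gives a linear relation between the
  triple intersection numbers \<open>[i j k]\<close> of three vertices \<open>u\<close>, \<open>v\<close>, \<open>w\<close>. If these are mutually at
  distance 2, the relations and the marginals \<open>p\<^sup>2\<^sub>i\<^sub>j\<close> yield \<open>12 [1 1 1] + [5 5 5] = 20\<close>, so three such
  vertices have at most one common neighbour. Now fix \<open>v\<close>, \<open>w\<close> at distance 2. Each of their 5 common
  neighbours has 53 further neighbours, all at distance 2 from \<open>v\<close> and \<open>w\<close>; but only
  \<open>p\<^sup>2\<^sub>2\<^sub>2 = 243 < 5 * 53\<close> vertices are at distance 2 from both.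
\<close>

section \<open>Distances in connected graphs\<close>

lemma (in wf_digraph) gdist_le_length: "awalk u p v \<Longrightarrow> gdist G u v \<le> length p"
  unfolding gdist_def by (intro Least_le) auto

lemma (in wf_digraph) shortest_awalk:
  assumes "u \<rightarrow>\<^sup>* v"
  obtains p where "awalk u p v" "length p = gdist G u v"
proof -
  have "\<exists>n p. awalk u p v \<and> length p = n"
    using assms by (auto simp: reachable_awalk)
  from LeastI_ex[OF this] show ?thesis
    using that unfolding gdist_def by auto
qed

text \<open>Symmetry supplies an opposite arc for each arc of the walk; this is what makes
  \<open>gdist\<close> symmetric.\<close>

lemma (in sym_digraph) awalk_reverse:
  assumes "awalk u p v"
  shows "\<exists>q. awalk v q u \<and> length q = length p"
  using assms
proof (induction p arbitrary: u)
  case Nil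
  then show ?case by (auto simp: awalk_Nil_iff intro!: exI[of _ "[]"])
next
  case (Cons a p)
  then have a: "a \<in> arcs G" "u = tail G a" and p: "awalk (head G a) p v"
    by (auto simp: awalk_Cons_iff)
  from Cons.IH[OF p] obtain q where q: "awalk v q (head G a)" "length q = length p" by blast
  have "(head G a, tail G a) \<in> arcs_ends G"
    using a(1) sym_arcs by (auto simp: symmetric_def sym_def arcs_ends_def arc_to_ends_def)
  then obtain a' where a': "a' \<in> arcs G" "tail G a' = head G a" "head G a' = tail G a"
    by (auto simp: arcs_ends_def arc_to_ends_def)
  have "awalk (head G a) [a'] u"
    using a a' by (auto simp: awalk_Cons_iff awalk_Nil_iff)
  then have "awalk v (q @ [a']) u"
    using q(1) by (rule awalk_appendI[rotated])
  then show ?case using q(2) by (intro exI[of _ "q @ [a']"]) auto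
qed

lemma (in sym_digraph) gdist_commute:
  assumes "strongly_connected G" "u \<in> verts G" "v \<in> verts G"
  shows "gdist G u v = gdist G v u"
proof -
  have "gdist G x y \<le> gdist G y x" if xy: "x \<in> verts G" "y \<in> verts G" for x y
  proof -
    have "y \<rightarrow>\<^sup>* x" using assms(1) xy by auto
    then obtain p where "awalk y p x" "length p = gdist G y x" by (rule shortest_awalk)
    then show ?thesis using awalk_reverse gdist_le_length by metis
  qed
  then show ?thesis using assms(2,3) by (simp add: antisym)
qed

lemma (in wf_digraph) gdist_triangle:
  assumes "strongly_connected G" "u \<in> verts G" "v \<in> verts G" "w \<in> verts G"
  shows "gdist G u w \<le> gdist G u v + gdist G v w"
proof -
  have "u \<rightarrow>\<^sup>* v" "v \<rightarrow>\<^sup>* w" using assms by auto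
  then obtain p q where "awalk u p v" "length p = gdist G u v"
    and "awalk v q w" "length q = gdist G v w" using shortest_awalk by metis
  then show ?thesis using gdist_le_length[OF awalk_appendI, of u p v q w] by simp
qed

lemma (in wf_digraph) gdist_eq_0_iff:
  assumes "strongly_connected G" "u \<in> verts G" "v \<in> verts G"
  shows "gdist G u v = 0 \<longleftrightarrow> u = v"
proof
  assume 0: "gdist G u v = 0"
  have "u \<rightarrow>\<^sup>* v" using assms by auto
  then show "u = v" using shortest_awalk[of u v] 0 by (metis awalk_Nil_iff length_0_conv)
next
  assume "u = v"
  then have "awalk u [] v" using assms by (simp add: awalk_Nil_iff)
  then show "gdist G u v = 0" using gdist_le_length by fastforce
qed

lemma (in fin_digraph) gdist_le_gdiameter:
  assumes "u \<in> verts G" "v \<in> verts G"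
  shows "gdist G u v \<le> gdiameter G"
proof -
  have "{gdist G u v | u v. u \<in> verts G \<and> v \<in> verts G} = (\<lambda>(u, v). gdist G u v) ` (verts G \<times> verts G)"
    by auto
  then have "finite {gdist G u v | u v. u \<in> verts G \<and> v \<in> verts G}" by simp
  then show ?thesis unfolding gdiameter_def using assms by (intro Max_ge) auto
qed

section \<open>Bipartite intersection arrays\<close>

text \<open>
  If \<open>F\<close> is regarded as the function \<open>x \<mapsto> F (d x y)\<close>, then \<open>conv b c i F\<close> describes its product
  with the \<open>i\<close>-th distance matrix \<open>A\<^sub>i\<close>; the recursion is
  \<open>c\<^sub>i\<^sub>+\<^sub>2 A\<^sub>i\<^sub>+\<^sub>2 = A\<^sub>1 A\<^sub>i\<^sub>+\<^sub>1 - b\<^sub>i A\<^sub>i\<close>.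
\<close>
fun conv :: "(nat \<Rightarrow> real) \<Rightarrow> (nat \<Rightarrow> real) \<Rightarrow> nat \<Rightarrow> (nat \<Rightarrow> real) \<Rightarrow> nat \<Rightarrow> real" where
  "conv b c 0 F h = F h"
| "conv b c (Suc 0) F h = b h * F (Suc h) + c h * F (h - 1)"
| "conv b c (Suc (Suc i)) F h =
    (b h * conv b c (Suc i) F (Suc h) + c h * conv b c (Suc i) F (h - 1) - b i * conv b c i F h)
      / c (Suc (Suc i))"

text \<open>Expanding the square over pairs \<open>x\<close>, \<open>y\<close> makes the sums over
  \<open>u\<close>, \<open>v\<close>, \<open>w\<close> independent. Each factor on the right is an
  entry of a Gram matrix, which for a multiple of an idempotent is a multiple of the original
  entry.\<close>

lemma sum_triple_product_squared:
  fixes e f g :: "'a \<Rightarrow> 'a \<Rightarrow> real"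
  shows "(\<Sum>u\<in>V. \<Sum>v\<in>V. \<Sum>w\<in>V. (\<Sum>x\<in>V. e u x * f v x * g w x)\<^sup>2) =
    (\<Sum>x\<in>V. \<Sum>y\<in>V. (\<Sum>u\<in>V. e u x * e u y) * (\<Sum>v\<in>V. f v x * f v y) * (\<Sum>w\<in>V. g w x * g w y))"
proof -
  let ?t = "\<lambda>u v w q. (e u (fst q) * e u (snd q)) * (f v (fst q) * f v (snd q)) * (g w (fst q) * g w (snd q))"
  have fac: "(\<Sum>u\<in>V. \<Sum>v\<in>V. \<Sum>w\<in>V. ?t u v w q) =
      (\<Sum>u\<in>V. e u (fst q) * e u (snd q)) * (\<Sum>v\<in>V. f v (fst q) * f v (snd q)) * (\<Sum>w\<in>V. g w (fst q) * g w (snd q))"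
    for q by (simp flip: sum_distrib_left sum_distrib_right)
  have "(\<Sum>u\<in>V. \<Sum>v\<in>V. \<Sum>w\<in>V. (\<Sum>x\<in>V. e u x * f v x * g w x)\<^sup>2) =
    (\<Sum>u\<in>V. \<Sum>v\<in>V. \<Sum>w\<in>V. \<Sum>q\<in>V \<times> V. ?t u v w q)"
    by (simp add: power2_eq_square sum_product sum.cartesian_product case_prod_unfold mult_ac)
  also have "\<dots> = (\<Sum>q\<in>V \<times> V. \<Sum>u\<in>V. \<Sum>v\<in>V. \<Sum>w\<in>V. ?t u v w q)"
    by (simp only: sum.swap[where A = V and B = "V \<times> V"])
  finally show ?thesis
    unfolding fac by (simp add: sum.cartesian_product case_prod_unfold)
qed

text \<open>The final \<open>0\<close> in \<open>card_neighbours\<close> encodes a_i = 0: no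
  neighbour of \<open>x\<close> is as far from \<open>y\<close> as \<open>x\<close> is.
  \<open>c_0\<close> cancels the term \<open>F (h - 1)\<close> at \<open>h = 0\<close>, where the
  subtraction is truncated.\<close>

locale bipartite_distance_regular =
  fixes V :: "'a set" and d :: "'a \<Rightarrow> 'a \<Rightarrow> nat" and D :: nat and b c :: "nat \<Rightarrow> real"
  assumes finite_V: "finite V"
    and d_le: "x \<in> V \<Longrightarrow> y \<in> V \<Longrightarrow> d x y \<le> D"
    and d_commute: "x \<in> V \<Longrightarrow> y \<in> V \<Longrightarrow> d x y = d y x"
    and d_eq_0_iff: "x \<in> V \<Longrightarrow> y \<in> V \<Longrightarrow> d x y = 0 \<longleftrightarrow> x = y"
    and card_neighbours: "x \<in> V \<Longrightarrow> y \<in> V \<Longrightarrow>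
      real (card {z \<in> V. d x z = 1 \<and> d z y = j}) =
        (if j = Suc (d x y) then b (d x y) else if d x y = Suc j then c (d x y) else 0)"
    and c_0: "c 0 = 0"
    and c_nz: "0 < i \<Longrightarrow> i \<le> D \<Longrightarrow> c i \<noteq> 0"
begin

lemma sum_neighbours:
  assumes "x \<in> V" "y \<in> V"
  shows "(\<Sum>z\<in>{z \<in> V. d x z = 1}. F (d z y)) = b (d x y) * F (Suc (d x y)) + c (d x y) * F (d x y - 1)"
proof -
  let ?h = "d x y"
  have h: "?h \<le> D" using assms by (rule d_le)
  \<comment> \<open>The range ends at \<open>Suc D\<close> because \<open>Suc ?h\<close> exceeds
    \<open>D\<close> when \<open>?h = D\<close>.\<close>
  have "(\<Sum>z\<in>{z \<in> V. d x z = 1}. F (d z y)) =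
      (\<Sum>j\<le>Suc D. \<Sum>z\<in>{z \<in> {z \<in> V. d x z = 1}. d z y = j}. F (d z y))"
    using finite_V assms by (intro sum.group[symmetric]) (auto simp: le_SucI d_le)
  also have "\<dots> = (\<Sum>j\<le>Suc D. real (card {z \<in> V. d x z = 1 \<and> d z y = j}) * F j)"
    by (simp add: conj_assoc)
  also have "\<dots> = (\<Sum>j\<le>Suc D. (if j = Suc ?h then b ?h * F j else 0) + (if ?h = Suc j then c ?h * F j else 0))"
    unfolding card_neighbours[OF assms] by (intro sum.cong) auto
  also have "\<dots> = b ?h * F (Suc ?h) + c ?h * F (?h - 1)"
    using h by (cases ?h) (auto simp: sum.distrib c_0)
  finally show ?thesis .
qed

lemma sum_sphere:
  assumes "y \<in> V"
  shows "i \<le> D \<Longrightarrow> x \<in> V \<Longrightarrow> (\<Sum>z\<in>{z \<in> V. d x z = i}. F (d z y)) = conv b c i F (d x y)"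
proof (induction i arbitrary: x rule: induct_nat_012)
  case 0
  then have "{z \<in> V. d x z = 0} = {x}" by (auto simp: d_eq_0_iff)
  then show ?case by simp
next
  case 1
  then show ?case using assms sum_neighbours by simp
next
  case (ge2 i)
  let ?S = "\<lambda>i x. \<Sum>z\<in>{z \<in> V. d x z = i}. F (d z y)"
  have S: "?S i x = (\<Sum>z\<in>V. if d x z = i then F (d z y) else 0)" for i x
    using finite_V by (simp add: sum.inter_filter)
  let ?N = "{z \<in> V. d x z = 1}"
  \<comment> \<open>A neighbour \<open>x'\<close> of \<open>x\<close> at distance
    \<open>Suc i\<close> from \<open>z\<close> forces \<open>z\<close> to be at distance
    \<open>i\<close> or \<open>Suc (Suc i)\<close> from \<open>x\<close>; there are
    \<open>b i\<close> or \<open>c (Suc (Suc i))\<close> such neighbours.\<close>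
  have card: "(\<Sum>x'\<in>?N. if d x' z = Suc i then F (d z y) else 0) =
      b i * (if d x z = i then F (d z y) else 0) + c (Suc (Suc i)) * (if d x z = Suc (Suc i) then F (d z y) else 0)"
    if z: "z \<in> V" for z
  proof -
    have "(\<Sum>x'\<in>?N. if d x' z = Suc i then F (d z y) else 0) =
        (\<Sum>x'\<in>{x' \<in> ?N. d x' z = Suc i}. F (d z y))"
      using finite_V by (intro sum.inter_filter[symmetric]) auto
    also have "\<dots> = real (card {x' \<in> V. d x x' = 1 \<and> d x' z = Suc i}) * F (d z y)"
      by (simp add: conj_assoc)
    also have "\<dots> = b i * (if d x z = i then F (d z y) else 0) + c (Suc (Suc i)) * (if d x z = Suc (Suc i) then F (d z y) else 0)"
      by (simp only: card_neighbours[OF ge2.prems(2) z]) auto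
    finally show ?thesis .
  qed
  have "b (d x y) * conv b c (Suc i) F (Suc (d x y)) + c (d x y) * conv b c (Suc i) F (d x y - 1) =
      (\<Sum>x'\<in>?N. conv b c (Suc i) F (d x' y))"
    using sum_neighbours[of x y "conv b c (Suc i) F"] ge2.prems assms by simp
  also have "\<dots> = (\<Sum>x'\<in>?N. ?S (Suc i) x')"
    using ge2 by (intro sum.cong) auto
  also have "\<dots> = (\<Sum>z\<in>V. \<Sum>x'\<in>?N. if d x' z = Suc i then F (d z y) else 0)"
    unfolding S by (rule sum.swap)
  also have "\<dots> = b i * ?S i x + c (Suc (Suc i)) * ?S (Suc (Suc i)) x"
    unfolding S sum_distrib_left sum.distrib[symmetric] by (intro sum.cong refl card)
  also have "?S i x = conv b c i F (d x y)"
    using ge2 by simp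
  finally have "c (Suc (Suc i)) * ?S (Suc (Suc i)) x =
      b (d x y) * conv b c (Suc i) F (Suc (d x y)) + c (d x y) * conv b c (Suc i) F (d x y - 1)
        - b i * conv b c i F (d x y)" by simp
  moreover have "c (Suc (Suc i)) \<noteq> 0" using ge2.prems c_nz by simp
  ultimately show ?case by (simp add: eq_divide_eq mult.commute)
qed

text \<open>Products of matrices whose entries depend only on distance thus reduce to one numerical
  computation per distance.\<close>

lemma sum_conv:
  assumes "x \<in> V" "y \<in> V"
  shows "(\<Sum>z\<in>V. E (d x z) * F (d z y)) = (\<Sum>i\<le>D. E i * conv b c i F (d x y))"
proof -
  have "(\<Sum>z\<in>V. E (d x z) * F (d z y)) =
      (\<Sum>i\<le>D. \<Sum>z\<in>{z \<in> V. d x z = i}. E (d x z) * F (d z y))"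
    using finite_V assms by (intro sum.group[symmetric]) (auto simp: d_le)
  also have "\<dots> = (\<Sum>i\<le>D. E i * (\<Sum>z\<in>{z \<in> V. d x z = i}. F (d z y)))"
    by (simp add: sum_distrib_left)
  also have "\<dots> = (\<Sum>i\<le>D. E i * conv b c i F (d x y))"
    using assms by (intro sum.cong) (auto simp: sum_sphere)
  finally show ?thesis .
qed

text \<open>
  The assumptions say that \<open>e\<close>, \<open>f\<close>, \<open>g\<close> are multiples of primitive idempotents for which the
  Krein parameter vanishes. The sum of the squares of the left-hand side over all \<open>u\<close>, \<open>v\<close>, \<open>w\<close>
  is then a multiple of that Krein parameter.
\<close>
lemma vanishing_krein_parameter:
  assumes e: "\<And>h. h \<le> D \<Longrightarrow> (\<Sum>i\<le>D. e i * conv b c i e h) = \<alpha> * e h"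
    and f: "\<And>h. h \<le> D \<Longrightarrow> (\<Sum>i\<le>D. f i * conv b c i f h) = \<beta> * f h"
    and g: "\<And>h. h \<le> D \<Longrightarrow> (\<Sum>i\<le>D. g i * conv b c i g h) = \<gamma> * g h"
    and krein: "(\<Sum>i\<le>D. conv b c i (\<lambda>h. e h * f h * g h) 0) = 0"
    and uvw: "u \<in> V" "v \<in> V" "w \<in> V"
  shows "(\<Sum>x\<in>V. e (d u x) * f (d v x) * g (d w x)) = 0"
proof -
  let ?S = "\<lambda>u v w. (\<Sum>x\<in>V. e (d u x) * f (d v x) * g (d w x))\<^sup>2"
  have idem: "(\<Sum>u\<in>V. E (d u x) * E (d u y)) = \<mu> * E (d x y)"
    if "\<And>h. h \<le> D \<Longrightarrow> (\<Sum>i\<le>D. E i * conv b c i E h) = \<mu> * E h" "x \<in> V" "y \<in> V" for E \<mu> x y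
  proof -
    have "(\<Sum>u\<in>V. E (d u x) * E (d u y)) = (\<Sum>u\<in>V. E (d x u) * E (d u y))"
      using that by (intro sum.cong) (auto simp: d_commute)
    then show ?thesis using that by (simp add: sum_conv d_le)
  qed
  \<comment> \<open>\<open>conv b c i F 0\<close> sums \<open>F\<close> over the sphere of radius
    \<open>i\<close>, so \<open>krein\<close> says that each row of the entrywise product sums to
    0.\<close>
  have row: "(\<Sum>y\<in>V. e (d x y) * f (d x y) * g (d x y)) = 0" if "x \<in> V" for x
  proof -
    have "(\<Sum>y\<in>V. e (d x y) * f (d x y) * g (d x y)) = (\<Sum>y\<in>V. 1 * (e (d y x) * f (d y x) * g (d y x)))"
      using that by (intro sum.cong) (auto simp: d_commute)
    also have "\<dots> = 0"
      using sum_conv[OF that that, of "\<lambda>_. 1" "\<lambda>h. e h * f h * g h"] krein that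
      by (simp add: d_eq_0_iff[THEN iffD2])
    finally show ?thesis .
  qed
  have "(\<Sum>u\<in>V. \<Sum>v\<in>V. \<Sum>w\<in>V. ?S u v w) =
      (\<Sum>x\<in>V. \<Sum>y\<in>V. (\<alpha> * e (d x y)) * (\<beta> * f (d x y)) * (\<gamma> * g (d x y)))"
    unfolding sum_triple_product_squared by (intro sum.cong) (simp_all add: idem[OF e] idem[OF f] idem[OF g])
  also have "\<dots> = (\<Sum>x\<in>V. \<alpha> * \<beta> * \<gamma> * (\<Sum>y\<in>V. e (d x y) * f (d x y) * g (d x y)))"
    by (simp add: sum_distrib_left mult_ac)
  also have "\<dots> = 0"
    by (simp add: row)
  finally have "?S u v w = 0"
    using uvw finite_V by (simp add: sum_nonneg_eq_0_iff sum_nonneg)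
  then show ?thesis by simp
qed

section \<open>Triple intersection numbers and their marginals\<close>

definition triple :: "'a \<Rightarrow> 'a \<Rightarrow> 'a \<Rightarrow> nat \<Rightarrow> nat \<Rightarrow> nat \<Rightarrow> real" where
  "triple u v w i j k = real (card {x \<in> V. d u x = i \<and> d v x = j \<and> d w x = k})"

lemma triple_nonneg: "0 \<le> triple u v w i j k"
  by (simp add: triple_def)

lemma sum_triple:
  assumes "u \<in> V" "v \<in> V" "w \<in> V"
  shows "(\<Sum>x\<in>V. \<phi> (d u x) (d v x) (d w x)) = (\<Sum>i\<le>D. \<Sum>j\<le>D. \<Sum>k\<le>D. triple u v w i j k * \<phi> i j k)"
proof -
  let ?t = "\<lambda>x. (d u x, d v x, d w x)"
  have "(\<Sum>x\<in>V. \<phi> (d u x) (d v x) (d w x)) =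
    (\<Sum>q\<in>{..D} \<times> {..D} \<times> {..D}. \<Sum>x\<in>{x \<in> V. ?t x = q}. \<phi> (d u x) (d v x) (d w x))"
    using finite_V assms by (intro sum.group[symmetric]) (auto simp: d_le)
  also have "\<dots> = (\<Sum>(i, j, k)\<in>{..D} \<times> {..D} \<times> {..D}. triple u v w i j k * \<phi> i j k)"
    by (intro sum.cong) (auto simp: triple_def)
  finally show ?thesis by (simp add: sum.cartesian_product)
qed

text \<open>On the indicator function of \<open>j\<close>, \<open>conv\<close> evaluates the product
  A_i A_j, whose entry at distance h is p^h_ij.\<close>

lemma card_sphere_inter:
  assumes "u \<in> V" "v \<in> V" "i \<le> D"
  shows "real (card {x \<in> V. d u x = i \<and> d v x = j}) = conv b c i (\<lambda>h. if h = j then 1 else 0) (d u v)"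
proof -
  have "conv b c i (\<lambda>h. if h = j then 1 else 0) (d u v) = (\<Sum>x\<in>{x \<in> V. d u x = i}. if d x v = j then 1 else 0)"
    by (rule sum_sphere[where F = "\<lambda>h. if h = j then 1 else 0", symmetric]) (use assms in auto)
  also have "\<dots> = (\<Sum>x\<in>{x \<in> {x \<in> V. d u x = i}. d x v = j}. 1)"
    using finite_V by (intro sum.inter_filter[symmetric]) simp
  also have "\<dots> = (\<Sum>x\<in>{x \<in> V. d u x = i \<and> d v x = j}. 1)"
    using assms by (intro sum.cong) (auto simp: d_commute)
  finally show ?thesis by simp
qed

lemma sum_triple_third:
  assumes "u \<in> V" "v \<in> V" "w \<in> V" "i \<le> D"
  shows "(\<Sum>k\<le>D. triple u v w i j k) = conv b c i (\<lambda>h. if h = j then 1 else 0) (d u v)"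
proof -
  let ?A = "{x \<in> V. d u x = i \<and> d v x = j}"
  have "(\<Sum>x\<in>?A. 1) = (\<Sum>k\<le>D. \<Sum>x\<in>{x \<in> ?A. d w x = k}. 1 :: real)"
    using finite_V assms by (intro sum.group[symmetric]) (auto simp: d_le)
  also have "\<dots> = (\<Sum>k\<le>D. triple u v w i j k)"
    by (simp add: triple_def conj_assoc)
  finally show ?thesis using card_sphere_inter[OF assms(1,2,4), of j] by simp
qed

text \<open>Together with \<open>triple_rotate\<close>, this transports
  \<open>sum_triple_third\<close> to the other two coordinates.\<close>

lemma triple_swap23: "triple u v w i j k = triple u w v i k j"
  unfolding triple_def by (intro arg_cong[where f = real] arg_cong[where f = card]) auto

lemma triple_rotate: "triple u v w i j k = triple v w u j k i"
  unfolding triple_def by (intro arg_cong[where f = real] arg_cong[where f = card]) auto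

end

section \<open>The array \<open>{55,54,50,35,10;1,5,20,45,55}\<close>\<close>

text \<open>The lists are padded by b_5 = 0 and c_0 = 0. The former also cancels the out-of-range
  lookup at index 6 that \<open>conv\<close> makes at distance 5.\<close>

abbreviation b55 :: "nat \<Rightarrow> real" where "b55 \<equiv> (!) [55, 54, 50, 35, 10, 0]"
abbreviation c55 :: "nat \<Rightarrow> real" where "c55 \<equiv> (!) [0, 1, 5, 20, 45, 55]"

text \<open>
  Up to scaling, the columns of the dual eigenmatrix for the eigenvalues \<open>-20\<close> and \<open>-5\<close>.
\<close>
abbreviation dual4 :: "nat \<Rightarrow> real" where "dual4 \<equiv> (!) [198, -72, 23, -2, -12, 33]"
abbreviation dual3 :: "nat \<Rightarrow> real" where "dual3 \<equiv> (!) [693, -63, -7, 7, 3, -33]"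

lemma atMost_5: "{..5::nat} = {0, 1, 2, 3, 4, 5}"
  by auto

lemma le_5_cases:
  assumes "(i::nat) \<le> 5"
  obtains "i = 0" | "i = 1" | "i = 2" | "i = 3" | "i = 4" | "i = 5"
  using assms by linarith

text \<open>The graph would have 3500 vertices, and 198 = 3/2 * 132 with 132 the multiplicity of
  -20, so the factor is 3500 * 3/2. For \<open>dual3\<close>, 693 = 3/7 * 1617 and the factor is
  3500 * 3/7.\<close>

lemma dual4_idempotent:
  assumes "h \<le> 5"
  shows "(\<Sum>i\<le>5. dual4 i * conv b55 c55 i dual4 h) = 5250 * dual4 h"
  using assms by (elim le_5_cases) (simp_all add: atMost_5 eval_nat_numeral)

lemma dual3_idempotent:
  assumes "h \<le> 5"
  shows "(\<Sum>i\<le>5. dual3 i * conv b55 c55 i dual3 h) = 1500 * dual3 h"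
  using assms by (elim le_5_cases) (simp_all add: atMost_5 eval_nat_numeral)

lemma krein_444: "(\<Sum>i\<le>5. conv b55 c55 i (\<lambda>h. dual4 h * dual4 h * dual4 h) 0) = 0"
  by (simp add: atMost_5 eval_nat_numeral)

lemma krein_443: "(\<Sum>i\<le>5. conv b55 c55 i (\<lambda>h. dual4 h * dual4 h * dual3 h) 0) = 0"
  by (simp add: atMost_5 eval_nat_numeral)

text \<open>The zeros are the entries with \<open>i + j\<close> odd or with \<open>i\<close>,
  \<open>j\<close>, 2 violating the triangle inequality.\<close>

lemma intersection_numbers_2:
  assumes "i \<le> 5" "j \<le> 5"
  shows "conv b55 c55 i (\<lambda>h. if h = j then 1 else 0) 2 =
    [[0, 0, 1, 0, 0, 0], [0, 5, 0, 50, 0, 0], [1, 0, 243, 0, 350, 0],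
     [0, 50, 0, 1260, 0, 175], [0, 0, 350, 0, 805, 0], [0, 0, 0, 175, 0, 35]] ! i ! j"
  using assms by (elim le_5_cases) (simp_all add: eval_nat_numeral)

locale array55 = bipartite_distance_regular V d 5 b55 c55
  for V :: "'a set" and d :: "'a \<Rightarrow> 'a \<Rightarrow> nat"
begin

lemma triple_common_neighbours:
  assumes V: "u \<in> V" "v \<in> V" "w \<in> V" and d: "d u v = 2" "d v w = 2" "d u w = 2"
  shows "12 * triple u v w 1 1 1 + triple u v w 5 5 5 = 20"
proof -
  let ?N = "triple u v w"
  let ?T = "[[0, 0, 1, 0, 0, 0], [0, 5, 0, 50, 0, 0], [1, 0, 243, 0, 350, 0],
     [0, 50, 0, 1260, 0, 175], [0, 0, 350, 0, 805, 0], [0, 0, 0, 175, 0, 35]] :: real list list"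
  have T3: "(\<Sum>k\<le>5. ?N i j k) = ?T ! i ! j" if "i \<le> 5" "j \<le> 5" for i j
    using that V d sum_triple_third[of u v w i j] intersection_numbers_2 by simp
  have T2: "(\<Sum>k\<le>5. ?N i k j) = ?T ! i ! j" if "i \<le> 5" "j \<le> 5" for i j
    using that V d sum_triple_third[of u w v i j] intersection_numbers_2
    by (simp add: triple_swap23[of u v w])
  have T1: "(\<Sum>k\<le>5. ?N k i j) = ?T ! i ! j" if "i \<le> 5" "j \<le> 5" for i j
    using that V d sum_triple_third[of v w u i j] intersection_numbers_2
    by (simp add: triple_rotate[of u v w])
  have zero: "f k = 0" if "(\<Sum>k\<le>5. f k) = 0" "\<And>k. 0 \<le> f k" "k \<le> 5" for f :: "nat \<Rightarrow> real" and k
    using that by (simp add: sum_nonneg_eq_0_iff)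
  \<comment> \<open>A vanishing marginal kills all its nonnegative summands.\<close>
  have Z3: "?N i j k = 0" if "?T ! i ! j = 0" "i \<le> 5" "j \<le> 5" "k \<le> 5" for i j k
    using zero[of "?N i j" k] T3[of i j] that by (simp add: triple_nonneg)
  have Z2: "?N i k j = 0" if "?T ! i ! j = 0" "i \<le> 5" "j \<le> 5" "k \<le> 5" for i j k
    using zero[of "\<lambda>k. ?N i k j" k] T2[of i j] that by (simp add: triple_nonneg)
  have Z1: "?N k i j = 0" if "?T ! i ! j = 0" "i \<le> 5" "j \<le> 5" "k \<le> 5" for i j k
    using zero[of "\<lambda>k. ?N k i j" k] T1[of i j] that by (simp add: triple_nonneg)
  note Z = Z1 Z2 Z3
  \<comment> \<open>The surviving entries have three indices of equal parity. The marginals express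
    the odd ones through \<open>a\<close> and \<open>x\<close>, the even ones through
    \<open>y\<close>.\<close>
  define a where "a = ?N 1 1 1"
  define x where "x = ?N 5 5 5"
  define y where "y = ?N 4 4 4"
  have n0: "?N 0 2 2 = 1" "?N 2 0 2 = 1" "?N 2 2 0 = 1"
    using T3[of 0 2] T3[of 2 0] T2[of 2 0] by (simp_all add: atMost_5 Z)
  have n113: "?N 1 1 3 = 5 - a" "?N 1 3 1 = 5 - a" "?N 3 1 1 = 5 - a"
    using T3[of 1 1] T2[of 1 1] T1[of 1 1] by (simp_all add: atMost_5 Z a_def)
  have n133: "?N 1 3 3 = 45 + a" "?N 3 1 3 = 45 + a" "?N 3 3 1 = 45 + a"
    using T3[of 1 3] T3[of 3 1] T2[of 3 1] n113 by (simp_all add: atMost_5 Z)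
  have n355: "?N 5 5 3 = 35 - x" "?N 5 3 5 = 35 - x" "?N 3 5 5 = 35 - x"
    using T3[of 5 5] T2[of 5 5] T1[of 5 5] by (simp_all add: atMost_5 Z x_def)
  have n335: "?N 5 3 3 = 140 + x" "?N 3 5 3 = 140 + x" "?N 3 3 5 = 140 + x"
    using T3[of 5 3] T3[of 3 5] T2[of 3 5] n355 by (simp_all add: atMost_5 Z)
  have n333: "?N 3 3 3 = 1075 - a - x"
    using T3[of 3 3] n133 n335 by (simp add: atMost_5 Z)
  have n244: "?N 4 4 2 = 805 - y" "?N 4 2 4 = 805 - y" "?N 2 4 4 = 805 - y"
    using T3[of 4 4] T2[of 4 4] T1[of 4 4] by (simp_all add: atMost_5 Z y_def)
  have n224: "?N 4 2 2 = y - 455" "?N 2 4 2 = y - 455" "?N 2 2 4 = y - 455"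
    using T3[of 4 2] T3[of 2 4] T2[of 2 4] n244 by (simp_all add: atMost_5 Z)
  have n222: "?N 2 2 2 = 697 - y"
    using T3[of 2 2] n0 n224 by (simp add: atMost_5 Z)
  note N = n0 n113 n133 n355 n335 n333 n244 n224 n222 a_def[symmetric] x_def[symmetric] y_def[symmetric]
  have K4: "(\<Sum>i\<le>5. \<Sum>j\<le>5. \<Sum>k\<le>5. ?N i j k * (dual4 i * dual4 j * dual4 k)) = 0"
    using vanishing_krein_parameter[OF dual4_idempotent dual4_idempotent dual4_idempotent krein_444 V]
    by (subst sum_triple[OF V, symmetric])
  have K3: "(\<Sum>i\<le>5. \<Sum>j\<le>5. \<Sum>k\<le>5. ?N i j k * (dual4 i * dual4 j * dual3 k)) = 0"
    using vanishing_krein_parameter[OF dual4_idempotent dual4_idempotent dual3_idempotent krein_443 V]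
    by (subst sum_triple[OF V, symmetric])
  \<comment> \<open>Divided by 42875, \<open>K4\<close> has the unknown part -8a + x - y; divided by
    12250, \<open>K3\<close> has -28a - 4x + y. Adding them eliminates \<open>y\<close>.\<close>
  have "12 * a + x = 20"
    using K4 K3 by (simp add: atMost_5 Z N[simplified] Z[simplified])
  then show ?thesis by (simp add: a_def x_def)
qed


section \<open>Double counting around two vertices at distance 2\<close>

lemma no_vertices_at_distance_2:
  assumes V: "v \<in> V" "w \<in> V" and d2: "d v w = 2"
  shows False
proof -
  let ?M = "{u \<in> V. d v u = 2 \<and> d w u = 2}"
  let ?Z = "{z \<in> V. d v z = 1 \<and> d w z = 1}"
  let ?t = "\<lambda>u z. if d u z = 1 then 1 else 0 :: real"
  have fin: "finite ?M" "finite ?Z" using finite_V by auto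
  have M: "real (card ?M) = 243"
    using card_sphere_inter[OF V, of 2 2] intersection_numbers_2[of 2 2] d2 by simp
  have Z: "real (card ?Z) = 5"
    using card_sphere_inter[OF V, of 1 1] intersection_numbers_2[of 1 1] d2 by simp
  have upper: "(\<Sum>z\<in>?Z. ?t u z) \<le> 1" if u: "u \<in> ?M" for u
  proof -
    let ?C = "{z \<in> ?Z. d u z = 1}"
    have "12 * triple u v w 1 1 1 \<le> 20"
      using triple_common_neighbours[of u v w] triple_nonneg[of u v w 5 5 5] u V d2 d_commute by auto
    moreover have "triple u v w 1 1 1 = real (card ?C)"
      by (auto simp: triple_def intro!: arg_cong[where f = card])
    \<comment> \<open>Integrality enters here: 20/12 < 2.\<close>
    ultimately have "card ?C \<le> 1" by linarith
    then have "(\<Sum>z\<in>?C. 1) \<le> (1 :: real)" by simp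
    also have "(\<Sum>z\<in>?C. 1) = (\<Sum>z\<in>?Z. ?t u z)"
      using fin by (intro sum.inter_filter) auto
    finally show ?thesis .
  qed
  have lower: "53 \<le> (\<Sum>u\<in>?M. ?t u z)" if z: "z \<in> ?Z" for z
  proof -
    have zV: "z \<in> V" "d z v = 1" "d z w = 1" using z V d_commute by auto
    \<comment> \<open>By bipartiteness, two neighbours of \<open>z\<close> can only be at distance 0
      or 2.\<close>
    have even: "d y u = 2 \<or> u = y" if y: "y \<in> V" "d z y = 1" and u: "u \<in> V" "d z u = 1" for y u
    proof (rule ccontr)
      assume "\<not> (d y u = 2 \<or> u = y)"
      then have "d u y \<noteq> 2" "d u y \<noteq> 0" using y u d_commute d_eq_0_iff by auto
      then have "real (card {x \<in> V. d z x = 1 \<and> d x y = d u y}) = 0"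
        using y zV(1) by (subst card_neighbours) auto
      then show False using finite_V u by auto
    qed
    have "55 = real (card {u \<in> V. d z u = 1})"
      using card_sphere_inter[OF zV(1) zV(1), of 1 1] zV d_eq_0_iff[of z z] by simp
    also have "{u \<in> V. d z u = 1} \<subseteq> {u \<in> ?M. d u z = 1} \<union> {v, w}"
      using even[OF V(1) zV(2)] even[OF V(2) zV(3)] d_commute[OF zV(1)] by fastforce
    then have "card {u \<in> V. d z u = 1} \<le> card ({u \<in> ?M. d u z = 1} \<union> {v, w})"
      using finite_V by (intro card_mono) auto
    also have "\<dots> \<le> card {u \<in> ?M. d u z = 1} + card {v, w}"
      by (rule card_Un_le)
    also have "card {v, w} \<le> 2"
      by (cases "v = w") auto
    finally have "53 \<le> real (card {u \<in> ?M. d u z = 1})" by linarith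
    also have "\<dots> = (\<Sum>u\<in>{u \<in> ?M. d u z = 1}. 1)" by simp
    also have "\<dots> = (\<Sum>u\<in>?M. ?t u z)"
      using fin by (intro sum.inter_filter) auto
    finally show ?thesis .
  qed
  have "265 = (\<Sum>z\<in>?Z. 53 :: real)" using Z by simp
  also have "\<dots> \<le> (\<Sum>z\<in>?Z. \<Sum>u\<in>?M. ?t u z)" by (intro sum_mono lower)
  also have "\<dots> = (\<Sum>u\<in>?M. \<Sum>z\<in>?Z. ?t u z)" by (rule sum.swap)
  also have "\<dots> \<le> (\<Sum>u\<in>?M. 1)" by (intro sum_mono upper)
  also have "\<dots> = 243" using M by simp
  finally show False by simp
qed

end

section \<open>From the graph to the locale\<close>

theorem theorem7:
  shows "\<not> (\<exists>G :: ('a, 'b) pre_digraph. distance_regular G \<and>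
           has_intersection_array G [55, 54, 50, 35, 10] [1, 5, 20, 45, 55])"
proof
  assume "\<exists>G :: ('a, 'b) pre_digraph. distance_regular G \<and>
           has_intersection_array G [55, 54, 50, 35, 10] [1, 5, 20, 45, 55]"
  then obtain G :: "('a, 'b) pre_digraph" and p where "graph G"
    and conn: "Digraph_Component.connected G"
    and diam: "gdiameter G = 5" and p: "intersection_numbers G p"
    and arr: "\<And>i. i < 5 \<Longrightarrow> [55, 54, 50, 35, 10] ! i = p i 1 (i + 1)"
      "\<And>i. i < 5 \<Longrightarrow> [1, 5, 20, 45, 55] ! i = p (i + 1) 1 i"
    unfolding distance_regular_def has_intersection_array_def by auto
  interpret graph G by fact
  have sc: "strongly_connected G"
    using symmetric_connected_imp_strongly_connected sym_arcs conn by blast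
  let ?d = "gdist G"
  note le5 = gdist_le_gdiameter[unfolded diam]
  have card_p: "card {w \<in> verts G. ?d u w = i \<and> ?d w v = j} = p (?d u v) i j"
    if "u \<in> verts G" "v \<in> verts G" "i \<le> 5" "j \<le> 5" for u v i j
  proof -
    have "card {w \<in> verts G. ?d u w = i \<and> ?d v w = j} = p (?d u v) i j"
      using p that le5 unfolding intersection_numbers_def diam by auto
    moreover have "{w \<in> verts G. ?d u w = i \<and> ?d w v = j} = {w \<in> verts G. ?d u w = i \<and> ?d v w = j}"
      using that gdist_commute[OF sc] by auto
    ultimately show ?thesis by simp
  qed
  \<comment> \<open>The second list of the array begins with c_1 but \<open>c55\<close> with c_0,
    hence the index \<open>Suc i\<close>.\<close>
  have entries: "real ([55, 54, 50, 35, 10] ! i) = b55 i" "real ([1, 5, 20, 45, 55] ! i) = c55 (Suc i)"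
    if "i < 5" for i
  proof -
    have "i \<le> 5" using that by simp
    then show "real ([55, 54, 50, 35, 10] ! i) = b55 i" "real ([1, 5, 20, 45, 55] ! i) = c55 (Suc i)"
      using that by (rule_tac le_5_cases[of i]; simp)+
  qed
  interpret array55 "verts G" ?d
  proof
    fix x y j assume xy: "x \<in> verts G" "y \<in> verts G"
    let ?h = "?d x y"
    let ?C = "\<lambda>j. {z \<in> verts G. ?d x z = 1 \<and> ?d z y = j}"
    have up: "real (card (?C (Suc ?h))) = b55 ?h"
    \<comment> \<open>The intersection numbers say nothing about distance 6, so the case
      \<open>?h = 5\<close> rests on the diameter and b_5 = 0.\<close>
    proof (cases "?h = 5")
      case True
      then have "?C (Suc ?h) = {}" using le5 xy(2) by force
      then show ?thesis using True by (simp only:) simp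
    next
      case False
      then have "?h < 5" using le5[OF xy] by simp
      then show ?thesis
        using card_p[OF xy, of 1 "Suc ?h"] arr(1)[of ?h] entries(1)[of ?h] by simp
    qed
    have down: "real (card (?C j)) = c55 ?h" if "?h = Suc j" for j
      using that le5[OF xy] card_p[OF xy, of 1 j] arr(2)[of j] entries(2)[of j] by simp
    have near: "?d z y = ?h \<or> ?d z y = Suc ?h \<or> Suc (?d z y) = ?h" if "z \<in> verts G" "?d x z = 1" for z
      using gdist_triangle[OF sc that(1) xy] gdist_triangle[OF sc xy(1) that(1) xy(2)]
        gdist_commute[OF sc that(1) xy(1)] that by linarith
    \<comment> \<open>Bipartiteness comes from counting: the 55 neighbours of \<open>x\<close> split
      into a_h + b_h + c_h, and b_h + c_h = 55 for every h.\<close>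
    have level: "card (?C ?h) = 0"
    proof -
      have "{z \<in> verts G. ?d x z = 1} = {z \<in> verts G. ?d x z = 1 \<and> ?d z x = 1}"
        using gdist_commute[OF sc] xy by auto
      then have "card {z \<in> verts G. ?d x z = 1} = 55"
        using card_p[OF xy(1) xy(1), of 1 1] arr(1)[of 0] gdist_eq_0_iff[OF sc xy(1) xy(1)] by simp
      moreover have "{z \<in> verts G. ?d x z = 1} = ?C ?h \<union> (?C (Suc ?h) \<union> {z \<in> verts G. ?d x z = 1 \<and> Suc (?d z y) = ?h})"
        using near by blast
      moreover have "card (?C ?h \<union> (?C (Suc ?h) \<union> {z \<in> verts G. ?d x z = 1 \<and> Suc (?d z y) = ?h})) =
          card (?C ?h) + (card (?C (Suc ?h)) + card {z \<in> verts G. ?d x z = 1 \<and> Suc (?d z y) = ?h})"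
        by (subst card_Un_disjoint, simp, simp, force)+ simp
      ultimately have "card (?C ?h) + (card (?C (Suc ?h)) + card {z \<in> verts G. ?d x z = 1 \<and> Suc (?d z y) = ?h}) = 55"
        by metis
      \<comment> \<open>With the condition written as \<open>Suc (?d z y) = ?h\<close>, the set is
        empty at \<open>?h = 0\<close>, in agreement with c_0 = 0.\<close>
      moreover have "real (card {z \<in> verts G. ?d x z = 1 \<and> Suc (?d z y) = ?h}) = c55 ?h"
        using down by (cases ?h) auto
      ultimately have "real (card (?C ?h)) + (b55 ?h + c55 ?h) = 55"
        unfolding up[symmetric] by linarith
      moreover have "b55 ?h + c55 ?h = 55"
        using le5[OF xy] by (rule le_5_cases) simp_all
      ultimately show ?thesis by simp
    qed
    have far: "?C j = {}" if "j \<noteq> ?h" "j \<noteq> Suc ?h" "?h \<noteq> Suc j" for j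
    proof (rule ccontr)
      assume "?C j \<noteq> {}"
      then obtain z where z: "z \<in> verts G" "?d x z = 1" "?d z y = j" by auto
      show False using near[OF z(1,2)] that unfolding z(3) by auto
    qed
    show "real (card (?C j)) = (if j = Suc ?h then b55 ?h else if ?h = Suc j then c55 ?h else 0)"
    proof -
      consider "j = Suc ?h" | "j \<noteq> Suc ?h" "?h = Suc j" | "j \<noteq> Suc ?h" "?h \<noteq> Suc j"
        by blast
      then show ?thesis
      proof cases
        case 1
        show ?thesis unfolding if_P[OF 1] using up unfolding 1 .
      next
        case 2
        show ?thesis unfolding if_not_P[OF 2(1)] if_P[OF 2(2)] by (rule down[OF 2(2)])
      next
        case 3
        have "card (?C j) = 0" using level far[OF _ 3] by (cases "j = ?h") (simp_all only: card.empty simp_thms)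
        then show ?thesis unfolding if_not_P[OF 3(1)] if_not_P[OF 3(2)] by (simp only: of_nat_0)
      qed
    qed
  next
    fix i :: nat assume "0 < i" "i \<le> 5"
    then show "c55 i \<noteq> 0" by (elim le_5_cases) simp_all
  qed (auto intro: le5 gdist_commute[OF sc] simp: gdist_eq_0_iff[OF sc])
  obtain v where v: "v \<in> verts G" using sc by (auto simp: strongly_connected_def)
  \<comment> \<open>A pair at distance 2 exists because a sphere of radius 2 has p^0_22 = 594
    vertices.\<close>
  have "conv b55 c55 2 (\<lambda>h. if h = 2 then 1 else 0) 0 = 594"
    by (simp add: eval_nat_numeral)
  then have "real (card {w \<in> verts G. ?d v w = 2 \<and> ?d v w = 2}) = 594"
    using card_sphere_inter[OF v v, of 2 2] gdist_eq_0_iff[OF sc v v] by simp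
  then have "{w \<in> verts G. ?d v w = 2 \<and> ?d v w = 2} \<noteq> {}"
    by (metis card.empty of_nat_0 zero_neq_numeral)
  then show False using no_vertices_at_distance_2 v by blast
qed

end
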